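(* Let $K$, $\mathcal{E}$, $\mu$, the finite set $E\subset K$ and the space $\mathcal{H}_E$ of piecewise harmonic splines be as in the context. There exists a set of weights (real numbers) $\{p(x)\}_{x\in E}$ such that $$\int_K v\,d\mu=\sum_{x\in E}p(x)v(x)\qquad\text{for all } v\in\mathcal{H}_E.$$
   Context: $K$ is a p.c.f. (post-critically finite) self-similar fractal in the sense of Kigami, generated by a finite family $\{F_i\}$ of contractive similarities of a Euclidean space: $K=\bigcup_i F_iK$, and there is a finite boundary set $V_0\subset K$ with $F_iK\cap F_jK\subseteq F_iV_0\cap F_jV_0$ for $i\ne j$. $K$ carries a regular harmonic structure, i.e. a self-similar energy (local regular Dirichlet form) $\mathcal{E}(u,v)$ with domain $\operatorname{dom}\mathcal{E}=\{u:\mathcal{E}(u)<\infty\}\subset C(K)$, where $\mathcal{E}(u)=\mathcal{E}(u,u)=\sum_i r_i^{-1}\mathcal{E}(u\circ F_i)$ with constants $0<r_i<1$. $\mu$ is a non-atomic Borel probability measure on $K$ that is positive on nonempty open sets. $E\subset K$ is a finite nonempty set. $\mathcal{H}_E$ is the space of piecewise harmonic splines with nodes in $E$: the continuous functions $v$ with $\Delta_\mu v=0$ on $K\setminus E$ (at points of $V_0\setminus E$ this means vanishing of the normal derivative); equivalently, $v\in\operatorname{dom}\mathcal{E}$ with $\mathcal{E}(v,\varphi)=0$ for all $\varphi\in\operatorname{dom}\mathcal{E}$ with $\varphi|_E=0$. This condition does not depend on $\mu$. $\mathcal{H}_E$ has dimension $\#E$ and each $v\in\mathcal{H}_E$ is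 uniquely determined by its (arbitrary) values on $E$. *)

theory Defs
  imports "HOL-Probability.Probability"
begin

text \<open>
  The finite index alphabet is a finite type 'i. Finite words are lists; since
  foldr F [w1, ..., wm] x = F w1 (... (F wm x)), the map F_w is just foldr F w.
  Infinite words are functions from nat to 'i. Functions on K are represented by functions on
  the ambient space, of which only the values on K matter.
\<close>

definition contractive_similarity :: "('a::metric_space \<Rightarrow> 'a) \<Rightarrow> bool" where
  "contractive_similarity f \<longleftrightarrow>
     (\<exists>s. 0 < s \<and> s < 1 \<and> (\<forall>x y. dist (f x) (f y) = s * dist x y))"

definition self_similar_set :: "('i::finite \<Rightarrow> 'a::euclidean_space \<Rightarrow> 'a) \<Rightarrow> 'a set \<Rightarrow> bool" where
  "self_similar_set F K \<longleftrightarrow>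
     (\<forall>i. contractive_similarity (F i)) \<and> compact K \<and> K \<noteq> {} \<and> K = (\<Union>i. F i ` K)"

text \<open>
  Kigami's projection from infinite words to K. The intersection of the nested compact cells is
  a single point for every self-similar set, so the definite description is meaningful.
\<close>
definition coding :: "('i::finite \<Rightarrow> 'a::euclidean_space \<Rightarrow> 'a) \<Rightarrow> 'a set \<Rightarrow> (nat \<Rightarrow> 'i) \<Rightarrow> 'a" where
  "coding F K \<omega> = (THE x. \<forall>n. x \<in> foldr F (map \<omega> [0..<n]) ` K)"

definition critical_words :: "('i::finite \<Rightarrow> 'a::euclidean_space \<Rightarrow> 'a) \<Rightarrow> 'a set \<Rightarrow> (nat \<Rightarrow> 'i) set" where
  "critical_words F K = {\<omega>. \<exists>i j. i \<noteq> j \<and> coding F K \<omega> \<in> F i ` K \<inter> F j ` K}"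

definition postcritical_words :: "('i::finite \<Rightarrow> 'a::euclidean_space \<Rightarrow> 'a) \<Rightarrow> 'a set \<Rightarrow> (nat \<Rightarrow> 'i) set" where
  "postcritical_words F K = {(\<lambda>k. \<omega> (n + k)) | \<omega> n. 1 \<le> n \<and> \<omega> \<in> critical_words F K}"

definition pcf_self_similar_set :: "('i::finite \<Rightarrow> 'a::euclidean_space \<Rightarrow> 'a) \<Rightarrow> 'a set \<Rightarrow> bool" where
  "pcf_self_similar_set F K \<longleftrightarrow> self_similar_set F K \<and> finite (postcritical_words F K)"

text \<open>
  The boundary V_0. For a p.c.f. self-similar set it is a finite subset of K, and for i and j
  distinct, F i ` K \<inter> F j ` K is contained in F i ` V_0 \<inter> F j ` V_0.
\<close>
definition boundary :: "('i::finite \<Rightarrow> 'a::euclidean_space \<Rightarrow> 'a) \<Rightarrow> 'a set \<Rightarrow> 'a set" where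
  "boundary F K = coding F K ` postcritical_words F K"

text \<open>
  The initial form on V_0 is given by conductances c. The factor 1/2 compensates for every edge
  being counted in both directions.
\<close>
definition energy0 :: "'a set \<Rightarrow> ('a \<Rightarrow> 'a \<Rightarrow> real) \<Rightarrow> ('a \<Rightarrow> real) \<Rightarrow> ('a \<Rightarrow> real) \<Rightarrow> real" where
  "energy0 V c u v = (1/2) * (\<Sum>x\<in>V. \<Sum>y\<in>V. c x y * (u x - u y) * (v x - v y))"

definition energy_level ::
  "('i::finite \<Rightarrow> 'a::euclidean_space \<Rightarrow> 'a) \<Rightarrow> 'a set \<Rightarrow> ('a \<Rightarrow> 'a \<Rightarrow> real) \<Rightarrow> ('i \<Rightarrow> real) \<Rightarrow> nat
     \<Rightarrow> ('a \<Rightarrow> real) \<Rightarrow> ('a \<Rightarrow> real) \<Rightarrow> real" where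
  "energy_level F K c r m u v =
     (\<Sum>w | length w = m.
        inverse (prod_list (map r w)) * energy0 (boundary F K) c (u \<circ> foldr F w) (v \<circ> foldr F w))"

text \<open>
  The last clause is the compatibility condition: the energy of u on V_0 is the minimum of the
  level-one energies of all extensions v of u to V_1 (the union of the sets F i ` V_0).
  The reference to values outside V_1 is harmless, as the level-one energy ignores them.
\<close>
definition harmonic_structure ::
  "('i::finite \<Rightarrow> 'a::euclidean_space \<Rightarrow> 'a) \<Rightarrow> 'a set \<Rightarrow> ('a \<Rightarrow> 'a \<Rightarrow> real) \<Rightarrow> ('i \<Rightarrow> real) \<Rightarrow> bool" where
  "harmonic_structure F K c r \<longleftrightarrow>
     (let V0 = boundary F K; E0 = energy0 V0 c; E1 = energy_level F K c r 1 in
       (\<forall>x\<in>V0. \<forall>y\<in>V0. c x y = c y x \<and> 0 \<le> c x y) \<and>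
       (\<forall>u. E0 u u = 0 \<longleftrightarrow> (\<exists>a. \<forall>x\<in>V0. u x = a)) \<and>
       (\<forall>i. 0 < r i) \<and>
       (\<forall>u. (\<forall>v. (\<forall>x\<in>V0. v x = u x) \<longrightarrow> E0 u u \<le> E1 v v) \<and>
            (\<exists>v. (\<forall>x\<in>V0. v x = u x) \<and> E1 v v = E0 u u)))"

definition regular_harmonic_structure ::
  "('i::finite \<Rightarrow> 'a::euclidean_space \<Rightarrow> 'a) \<Rightarrow> 'a set \<Rightarrow> ('a \<Rightarrow> 'a \<Rightarrow> real) \<Rightarrow> ('i \<Rightarrow> real) \<Rightarrow> bool" where
  "regular_harmonic_structure F K c r \<longleftrightarrow> harmonic_structure F K c r \<and> (\<forall>i. r i < 1)"

text \<open>
  The self-similar energy is the limit of the level energies. For a harmonic structure the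
  sequence of level energies of u is nondecreasing, so its convergence says that the energy of u
  is finite.
\<close>
definition dom_energy ::
  "('i::finite \<Rightarrow> 'a::euclidean_space \<Rightarrow> 'a) \<Rightarrow> 'a set \<Rightarrow> ('a \<Rightarrow> 'a \<Rightarrow> real) \<Rightarrow> ('i \<Rightarrow> real)
     \<Rightarrow> ('a \<Rightarrow> real) set" where
  "dom_energy F K c r = {u. continuous_on K u \<and> convergent (\<lambda>m. energy_level F K c r m u u)}"

definition energy ::
  "('i::finite \<Rightarrow> 'a::euclidean_space \<Rightarrow> 'a) \<Rightarrow> 'a set \<Rightarrow> ('a \<Rightarrow> 'a \<Rightarrow> real) \<Rightarrow> ('i \<Rightarrow> real)
     \<Rightarrow> ('a \<Rightarrow> real) \<Rightarrow> ('a \<Rightarrow> real) \<Rightarrow> real" where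
  "energy F K c r u v = lim (\<lambda>m. energy_level F K c r m u v)"

text \<open>
  Piecewise harmonic splines with nodes in E, by the weak formulation. Test functions need not
  vanish on V_0 - E, which encodes the vanishing of the normal derivatives there.
\<close>
definition harmonic_splines ::
  "('i::finite \<Rightarrow> 'a::euclidean_space \<Rightarrow> 'a) \<Rightarrow> 'a set \<Rightarrow> ('a \<Rightarrow> 'a \<Rightarrow> real) \<Rightarrow> ('i \<Rightarrow> real) \<Rightarrow> 'a set
     \<Rightarrow> ('a \<Rightarrow> real) set" where
  "harmonic_splines F K c r E =
     {v \<in> dom_energy F K c r.
        \<forall>\<phi>\<in>dom_energy F K c r. (\<forall>x\<in>E. \<phi> x = 0) \<longrightarrow> energy F K c r v \<phi> = 0}"

definition borel_prob_on :: "'a::topological_space set \<Rightarrow> 'a measure \<Rightarrow> bool" where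
  "borel_prob_on K \<mu> \<longleftrightarrow> prob_space \<mu> \<and> sets \<mu> = sets (restrict_space borel K)"

definition nonatomic :: "'a measure \<Rightarrow> bool" where
  "nonatomic \<mu> \<longleftrightarrow>
     (\<forall>A\<in>sets \<mu>. 0 < emeasure \<mu> A \<longrightarrow>
        (\<exists>B\<in>sets \<mu>. B \<subseteq> A \<and> 0 < emeasure \<mu> B \<and> emeasure \<mu> B < emeasure \<mu> A))"

definition positive_on_open :: "'a::topological_space set \<Rightarrow> 'a measure \<Rightarrow> bool" where
  "positive_on_open K \<mu> \<longleftrightarrow> (\<forall>U. open U \<and> U \<inter> K \<noteq> {} \<longrightarrow> 0 < emeasure \<mu> (U \<inter> K))"

end

theory Submission
  imports Defs
begin

text \<open>
  Integration against \<open>\<mu>\<close> is a linear functional on the space of splines, so the weights exist as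
  soon as this functional depends only on the values on \<open>E\<close>: a linear functional that annihilates
  every function vanishing on a finite set is a combination of the point evaluations there
  (\<open>functional_is_combination_of_evaluations\<close>).

  What has to be shown is therefore uniqueness: a spline \<open>v\<close> that vanishes on \<open>E\<close> vanishes on \<open>K\<close>.
  Such a \<open>v\<close> is an admissible test function for itself, so its energy is zero. The level energies
  increase to the energy, because refining by one level is exactly the compatibility inequality of
  the harmonic structure applied in each cell; hence all of them vanish, and \<open>v\<close> is constant on
  the boundary \<open>F_w V_0\<close> of each cell \<open>F_w K\<close>. Distinct cells of the same level meet only in common
  boundary points (\<open>distinct_cells_meet_in_boundary\<close>), so meeting cells carry the same
  constant, and connectedness of \<open>K\<close> spreads one constant over all cells of a level. The cells
  shrink, so by uniform continuity \<open>v\<close> is constant on \<open>K\<close>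
  (\<open>constant_if_constant_on_cell_boundaries\<close>), and the constant is the value on \<open>E\<close>, which is 0.
\<close>

section \<open>Functionals determined by finitely many values\<close>

text \<open>
  The kernels of the point evaluations at \<open>E\<close> intersect inside the kernel of \<open>L\<close>. The induction
  removes one point \<open>e\<close> at a time: a function \<open>v0\<close> in \<open>S\<close> that vanishes on the other points but has
  \<open>L v0 \<noteq> 0\<close> dictates the weight of \<open>e\<close>, and subtracting that multiple of the evaluation at \<open>e\<close>
  leaves a functional determined by the remaining points.
\<close>
lemma functional_is_combination_of_evaluations:
  fixes L :: "('a \<Rightarrow> real) \<Rightarrow> real" and S :: "('a \<Rightarrow> real) set"
  assumes "finite E"
    and S_comb: "\<And>u v a. u \<in> S \<Longrightarrow> v \<in> S \<Longrightarrow> (\<lambda>x. u x + a * v x) \<in> S"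
    and "\<And>u v a. u \<in> S \<Longrightarrow> v \<in> S \<Longrightarrow> L (\<lambda>x. u x + a * v x) = L u + a * L v"
    and "\<And>v. v \<in> S \<Longrightarrow> (\<forall>x\<in>E. v x = 0) \<Longrightarrow> L v = 0"
  shows "\<exists>p. \<forall>v\<in>S. L v = (\<Sum>x\<in>E. p x * v x)"
  using assms(1,3,4)
proof (induction E arbitrary: L rule: finite_induct)
  case empty
  then show ?case by auto
next
  case (insert e E)
  have "\<exists>q. \<forall>v\<in>S. (\<forall>x\<in>E. v x = 0) \<longrightarrow> L v = q * v e"
  proof (cases "\<exists>v0\<in>S. (\<forall>x\<in>E. v0 x = 0) \<and> L v0 \<noteq> 0")
    case True
    then obtain v0 where v0: "v0 \<in> S" "\<forall>x\<in>E. v0 x = 0" "L v0 \<noteq> 0" by blast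
    then have nz: "v0 e \<noteq> 0" using insert.prems(2)[of v0] by auto
    have "L v = (L v0 / v0 e) * v e" if v: "v \<in> S" "\<forall>x\<in>E. v x = 0" for v
    proof -
      let ?a = "- (v e / v0 e)"
      have "L (\<lambda>x. v x + ?a * v0 x) = 0"
        using insert.prems(2)[of "\<lambda>x. v x + ?a * v0 x"] S_comb[OF v(1) v0(1), of ?a] v v0 nz
        by auto
      then show ?thesis using insert.prems(1)[OF v(1) v0(1), of ?a] nz by (simp add: field_simps)
    qed
    then show ?thesis by blast
  next
    case False
    then show ?thesis by (intro exI[of _ 0]) auto
  qed
  then obtain q where q: "\<And>v. v \<in> S \<Longrightarrow> \<forall>x\<in>E. v x = 0 \<Longrightarrow> L v = q * v e" by blast
  have "\<exists>p. \<forall>v\<in>S. L v - q * v e = (\<Sum>x\<in>E. p x * v x)"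
  proof (rule insert.IH)
    show "L (\<lambda>x. u x + a * v x) - q * (u e + a * v e) = L u - q * u e + a * (L v - q * v e)"
      if "u \<in> S" "v \<in> S" for u v a
      using insert.prems(1)[OF that, of a] by (simp add: algebra_simps)
  qed (use q in auto)
  then obtain p where p: "\<And>v. v \<in> S \<Longrightarrow> L v - q * v e = (\<Sum>x\<in>E. p x * v x)" by blast
  have "L v = (\<Sum>x\<in>insert e E. (p(e := q)) x * v x)" if "v \<in> S" for v
  proof -
    have "(\<Sum>x\<in>E. (p(e := q)) x * v x) = (\<Sum>x\<in>E. p x * v x)"
      using insert.hyps by (intro sum.cong) auto
    then show ?thesis using p[OF that] insert.hyps by simp
  qed
  then show ?case by blast
qed

text \<open>
  The cells that do and do not satisfy \<open>P\<close> have closed unions. These are disjoint when \<open>P\<close> passes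
  between meeting cells, so one of them must be empty.
\<close>
lemma connected_closed_cover_induct:
  assumes "connected (\<Union>w\<in>W. C w)" "finite W" "\<And>w. w \<in> W \<Longrightarrow> closed (C w)"
    and "\<And>w. w \<in> W \<Longrightarrow> C w \<noteq> {}"
    and "w0 \<in> W" "P w0"
    and "\<And>w w'. w \<in> W \<Longrightarrow> w' \<in> W \<Longrightarrow> P w \<Longrightarrow> C w \<inter> C w' \<noteq> {} \<Longrightarrow> P w'"
    and "w \<in> W"
  shows "P w"
proof (rule ccontr)
  assume "\<not> P w"
  define A where "A = (\<Union>w\<in>{w\<in>W. P w}. C w)"
  define B where "B = (\<Union>w\<in>{w\<in>W. \<not> P w}. C w)"
  have "closed A" "closed B" unfolding A_def B_def
    using assms(2,3) by (intro closed_UN; simp)+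
  moreover have "(\<Union>w\<in>W. C w) = A \<union> B" unfolding A_def B_def by auto
  moreover have "A \<inter> B = {}" unfolding A_def B_def using assms(7) by (auto simp: disjoint_iff)
  moreover have "C w0 \<subseteq> A" "C w \<subseteq> B"
    unfolding A_def B_def using assms(5,6,8) \<open>\<not> P w\<close> by auto
  then have "A \<noteq> {}" "B \<noteq> {}" using assms(4)[OF assms(5)] assms(4)[OF assms(8)] by auto
  ultimately show False
    using connected_closedD[of "A \<union> B" A B] assms(1) by auto
qed

section \<open>Cells and addresses\<close>

lemma foldr_append_comp: "foldr F (u @ w) = foldr F u \<circ> foldr F w"
  by (simp add: fun_eq_iff)

locale self_similar =
  fixes F :: "'i::finite \<Rightarrow> 'a::euclidean_space \<Rightarrow> 'a" and K :: "'a set"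
  assumes self_similar: "self_similar_set F K"
begin

lemma compact_K: "compact K" and K_nonempty: "K \<noteq> {}" and K_eq: "K = (\<Union>i. F i ` K)"
  using self_similar unfolding self_similar_set_def by - (elim conjE, assumption)+

lemma map_in_K: "x \<in> K \<Longrightarrow> F i x \<in> K"
  by (subst K_eq) blast

lemma word_map_in_K: "x \<in> K \<Longrightarrow> foldr F w x \<in> K"
  by (induction w) (auto intro: map_in_K)

lemma inj_map: "inj (F i)"
proof -
  obtain s where s: "0 < s" "\<And>x y. dist (F i x) (F i y) = s * dist x y"
    using self_similar unfolding self_similar_set_def contractive_similarity_def by blast
  show ?thesis
  proof (rule injI)
    fix x y assume "F i x = F i y"
    then have "s * dist x y = 0" using s(2)[of x y] by simp
    then show "x = y" using s(1) by simp
  qed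
qed

lemma inj_word_map: "inj (foldr F w)"
proof (induction w)
  case (Cons i w)
  then show ?case unfolding foldr_Cons by (rule inj_compose[OF inj_map])
qed simp

lemma word_map_contracts:
  obtains s where "0 < s" "s < 1"
    "\<And>w x y. dist (foldr F w x) (foldr F w y) \<le> s ^ length w * dist x y"
proof -
  have "\<forall>i. \<exists>s. 0 < s \<and> s < 1 \<and> (\<forall>x y. dist (F i x) (F i y) = s * dist x y)"
    using self_similar unfolding self_similar_set_def contractive_similarity_def by blast
  then obtain t where t: "\<And>i. 0 < t i" "\<And>i. t i < (1::real)"
    "\<And>i x y. dist (F i x) (F i y) = t i * dist x y" by metis
  define s where "s = Max (range t)"
  have ts: "t i \<le> s" for i unfolding s_def by (intro Max_ge) auto
  have s1: "s < 1" unfolding s_def using t(2) by (subst Max_less_iff) auto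
  have s0: "0 < s" using ts[of undefined] t(1)[of undefined] by linarith
  have "dist (foldr F w x) (foldr F w y) \<le> s ^ length w * dist x y" for w x y
  proof (induction w)
    case (Cons i w)
    have "t i * dist (foldr F w x) (foldr F w y) \<le> s * (s ^ length w * dist x y)"
      using Cons ts[of i] s0 by (intro mult_mono) auto
    then show ?case by (simp add: t(3) mult.assoc)
  qed simp
  then show ?thesis using that s0 s1 by blast
qed

lemma cells_shrink:
  assumes "0 < e"
  obtains m where "\<And>n w x y. m \<le> n \<Longrightarrow> length w = n \<Longrightarrow> x \<in> foldr F w ` K \<Longrightarrow> y \<in> foldr F w ` K
    \<Longrightarrow> dist x y < e"
proof -
  obtain s where s: "0 < s" "s < 1"
    "\<And>w x y. dist (foldr F w x) (foldr F w y) \<le> s ^ length w * dist x y"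
    by (rule word_map_contracts) blast
  define D where "D = diameter K + 1"
  have D: "dist x y \<le> D" if "x \<in> K" "y \<in> K" for x y
    using diameter_bounded_bound[OF compact_imp_bounded[OF compact_K] that] unfolding D_def by simp
  have D0: "0 < D" unfolding D_def
    using diameter_ge_0[OF compact_imp_bounded[OF compact_K]] by linarith
  obtain m where m: "s ^ m < e / D"
    using real_arch_pow_inv[of "e / D" s] s assms D0 by auto
  show ?thesis
  proof (rule that)
    fix n w x y
    assume *: "m \<le> n" "length w = n" "x \<in> foldr F w ` K" "y \<in> foldr F w ` K"
    then obtain x' y' where xy: "x' \<in> K" "y' \<in> K" "x = foldr F w x'" "y = foldr F w y'" by blast
    have "dist x y \<le> s ^ n * dist x' y'" using s(3)[of w x' y'] xy * by simp
    also have "\<dots> \<le> s ^ m * D"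
      using * s D[OF xy(1,2)] by (intro mult_mono power_decreasing) auto
    also have "\<dots> < e" using m D0 by (simp add: field_simps)
    finally show "dist x y < e" .
  qed
qed

lemma in_some_cell: "x \<in> K \<Longrightarrow> \<exists>w. length w = m \<and> x \<in> foldr F w ` K"
proof (induction m arbitrary: x)
  case (Suc m)
  obtain i y where iy: "y \<in> K" "x = F i y" using subsetD[OF equalityD1[OF K_eq] Suc.prems] by blast
  obtain w where "length w = m" "y \<in> foldr F w ` K" using Suc.IH[OF iy(1)] by blast
  then have "length (i # w) = Suc m" "x \<in> foldr F (i # w) ` K"
    using iy(2) by (auto simp: image_iff)
  then show ?case by blast
qed simp

lemma cells_cover: "(\<Union>w\<in>{w. length w = m}. foldr F w ` K) = K"
  using in_some_cell word_map_in_K by (intro equalityI subsetI) blast+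

text \<open>
  The relation between a point and the infinite words coding it avoids the definite description:
  it transfers along the maps \<open>F i\<close> without knowing that the coded point is unique.
\<close>
definition has_address :: "'a \<Rightarrow> (nat \<Rightarrow> 'i) \<Rightarrow> bool" where
  "has_address x \<omega> \<longleftrightarrow> (\<forall>n. x \<in> foldr F (map \<omega> [0..<n]) ` K)"

lemma coding_eqI:
  assumes "has_address x \<omega>"
  shows "coding F K \<omega> = x"
  unfolding coding_def
proof (rule the_equality)
  show "\<forall>n. x \<in> foldr F (map \<omega> [0..<n]) ` K" using assms unfolding has_address_def .
  fix y assume y: "\<forall>n. y \<in> foldr F (map \<omega> [0..<n]) ` K"
  show "y = x"
  proof (rule ccontr)
    assume "y \<noteq> x"
    then have "0 < dist y x" by simp
    then obtain m where m: "\<And>n w a b. m \<le> n \<Longrightarrow> length w = n \<Longrightarrow> a \<in> foldr F w ` K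
      \<Longrightarrow> b \<in> foldr F w ` K \<Longrightarrow> dist a b < dist y x" by (rule cells_shrink) blast
    have "dist y x < dist y x"
      using m[of m "map \<omega> [0..<m]" y x] y assms unfolding has_address_def by simp
    then show False by simp
  qed
qed

lemma address_exists:
  assumes "x \<in> K"
  obtains \<omega> where "has_address x \<omega>"
proof -
  have "\<forall>y\<in>K. \<exists>i. \<exists>z\<in>K. y = F i z" using equalityD1[OF K_eq] by blast
  then obtain d S where dS: "\<And>y. y \<in> K \<Longrightarrow> S y \<in> K \<and> y = F (d y) (S y)" by metis
  define \<omega> where "\<omega> n = d ((S ^^ n) x)" for n
  have "(S ^^ n) x \<in> K \<and> x = foldr F (map \<omega> [0..<n]) ((S ^^ n) x)" for n
  proof (induction n)
    case (Suc n)
    then show ?case using dS[of "(S ^^ n) x"] by (simp add: \<omega>_def)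
  qed (use assms in simp)
  then have "has_address x \<omega>" unfolding has_address_def by blast
  then show ?thesis by (rule that)
qed

lemma has_address_Cons:
  assumes "has_address x \<omega>"
  shows "has_address (F i x) (case_nat i \<omega>)"
  unfolding has_address_def
proof
  fix n
  have "x \<in> K" using assms[unfolded has_address_def, rule_format, of 0] by simp
  show "F i x \<in> foldr F (map (case_nat i \<omega>) [0..<n]) ` K"
  proof (cases n)
    case 0
    then show ?thesis using map_in_K[OF \<open>x \<in> K\<close>] by simp
  next
    case (Suc k)
    have "map (case_nat i \<omega>) [0..<Suc k] = i # map \<omega> [0..<k]"
      by (simp only: map_upt_Suc) simp
    then show ?thesis
      using assms[unfolded has_address_def, rule_format, of k] Suc by auto
  qed
qed

lemma has_address_append: "has_address x \<omega> \<Longrightarrow> has_address (foldr F w x) (foldr case_nat w \<omega>)"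
  by (induction w) (auto intro: has_address_Cons)

lemma shift_append: "foldr case_nat w \<omega> (length w + k) = \<omega> k"
  by (induction w) auto

text \<open>
  A point shared by two cells with different first letters has an address \<open>i s \<tau>\<close> that is critical,
  so the tail \<open>\<tau>\<close>, obtained by at least one shift, is post-critical and codes a boundary point.
\<close>
lemma meeting_point_in_boundary:
  assumes "i \<noteq> j" and "x \<in> foldr F (i # s) ` K" "x \<in> foldr F (j # t) ` K"
  shows "x \<in> foldr F (i # s) ` boundary F K"
proof -
  obtain y where y: "y \<in> K" "x = foldr F (i # s) y" using assms(2) by blast
  obtain \<tau> where \<tau>: "has_address y \<tau>" using address_exists[OF y(1)] .
  let ?\<omega> = "foldr case_nat (i # s) \<tau>"
  have "coding F K ?\<omega> = x" 
    using has_address_append[OF \<tau>, of "i # s"] unfolding y(2) by (rule coding_eqI)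
  moreover have "x \<in> F i ` K" "x \<in> F j ` K" using assms(2,3) word_map_in_K by auto
  ultimately have "?\<omega> \<in> critical_words F K" unfolding critical_words_def using assms(1) by auto
  moreover have "\<tau> = (\<lambda>k. ?\<omega> (length (i # s) + k))" by (rule ext) (rule shift_append[symmetric])
  ultimately have "\<tau> \<in> postcritical_words F K" unfolding postcritical_words_def
    by (intro CollectI exI[of _ ?\<omega>] exI[of _ "length (i # s)"]) auto
  then have "y \<in> boundary F K" unfolding boundary_def using coding_eqI[OF \<tau>] by blast
  then show ?thesis using y(2) by blast
qed

text \<open>
  Removing the common prefix of the two words by injectivity of the word maps leaves words with
  different first letters.
\<close>
lemma distinct_cells_meet_in_boundary:
  assumes "length w = length w'" "w \<noteq> w'" and "x \<in> foldr F w ` K" "x \<in> foldr F w' ` K"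
  shows "x \<in> foldr F w ` boundary F K \<and> x \<in> foldr F w' ` boundary F K"
proof -
  obtain u i j s t where w: "w = u @ i # s" "w' = u @ j # t" "i \<noteq> j"
    using same_length_different[OF assms(2,1)] by auto
  obtain y where y: "x = foldr F u y" "y \<in> foldr F (i # s) ` K"
    using assms(3) unfolding w(1) foldr_append_comp by auto
  obtain y' where y': "x = foldr F u y'" "y' \<in> foldr F (j # t) ` K"
    using assms(4) unfolding w(2) foldr_append_comp by auto
  have "y' = y" using y(1) y'(1) injD[OF inj_word_map] by metis
  then have "y \<in> foldr F (i # s) ` boundary F K" "y \<in> foldr F (j # t) ` boundary F K"
    using meeting_point_in_boundary[of i j y s t] meeting_point_in_boundary[of j i y t s] w(3) y y'
    by auto
  then show ?thesis unfolding w foldr_append_comp y(1) image_comp[symmetric] by blast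
qed

lemma compact_cell: "compact (foldr F w ` K)"
proof -
  obtain s where s: "0 < s" "s < 1"
    "\<And>w x y. dist (foldr F w x) (foldr F w y) \<le> s ^ length w * dist x y"
    by (rule word_map_contracts) blast
  have "(s ^ length w)-lipschitz_on K (foldr F w)"
    using s by (intro lipschitz_onI) auto
  then have "continuous_on K (foldr F w)" by (rule lipschitz_on_continuous_on)
  then show ?thesis using compact_K by (rule compact_continuous_image)
qed

text \<open>
  Every infinite word codes a point of \<open>K\<close>, because its nested compact cells have a common point.
\<close>
lemma boundary_subset: "boundary F K \<subseteq> K"
proof -
  have "coding F K \<omega> \<in> K" for \<omega>
  proof -
    let ?C = "\<lambda>n. foldr F (map \<omega> [0..<n]) ` K"
    have "decseq ?C"
      by (rule decseq_SucI) (auto simp: map_in_K)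
    then have dec: "?C n \<subseteq> ?C m" if "m \<le> n" for m n
      using that by (rule decseqD)
    have "(\<Inter>n. ?C n) \<noteq> {}"
    proof (rule compact_nest)
      fix n
      show "compact (?C n)" by (rule compact_cell)
      show "?C n \<noteq> {}" using K_nonempty by simp
    qed (rule dec)
    then obtain x where x: "has_address x \<omega>" unfolding has_address_def by blast
    then show ?thesis using coding_eqI[OF x] x[unfolded has_address_def, rule_format, of 0] by simp
  qed
  then show ?thesis unfolding boundary_def by blast
qed

text \<open>
  Given a level so fine that \<open>v\<close> varies by less than \<open>e\<close> on each cell, all boundary values at that
  level agree, because equality passes through the boundary points in which cells meet; so two
  values of \<open>v\<close> differ by less than \<open>2 * e\<close>.
\<close>
lemma constant_if_constant_on_cell_boundaries:
  fixes v :: "'a \<Rightarrow> real"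
  assumes "connected K" "continuous_on K v"
    and const: "\<And>w x y. x \<in> foldr F w ` boundary F K \<Longrightarrow> y \<in> foldr F w ` boundary F K \<Longrightarrow> v x = v y"
    and "x \<in> K" "y \<in> K"
  shows "v x = v y"
proof (rule ccontr)
  assume "v x \<noteq> v y"
  define e where "e = dist (v x) (v y) / 2"
  have "0 < e" using \<open>v x \<noteq> v y\<close> unfolding e_def by simp
  have "uniformly_continuous_on K v"
    using compact_uniformly_continuous[OF assms(2) compact_K] .
  then obtain d where d: "0 < d" "\<And>a b. a \<in> K \<Longrightarrow> b \<in> K \<Longrightarrow> dist b a < d \<Longrightarrow> dist (v b) (v a) < e"
    using \<open>0 < e\<close> unfolding uniformly_continuous_on_def by meson
  obtain m where m: "\<And>n w a b. m \<le> n \<Longrightarrow> length w = n \<Longrightarrow> a \<in> foldr F w ` K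
      \<Longrightarrow> b \<in> foldr F w ` K \<Longrightarrow> dist a b < d" using cells_shrink[OF d(1)] by blast
  have osc: "dist (v a) (v b) < e"
    if "length w = m" "a \<in> foldr F w ` K" "b \<in> foldr F w ` K" for w a b
    using d(2)[of b a] m[of m w a b] that word_map_in_K by auto
  obtain wx where wx: "length wx = m" "x \<in> foldr F wx ` K" using in_some_cell[OF assms(4)] by blast
  obtain wy where wy: "length wy = m" "y \<in> foldr F wy ` K" using in_some_cell[OF assms(5)] by blast
  define W where "W = {w :: 'i list. length w = m}"
  \<comment> \<open>The first disjunct covers an empty \<open>V_0\<close>: distinct cells then never meet, and only one exists.\<close>
  define P where "P w \<longleftrightarrow> w = wx \<or>
    (\<exists>a\<in>foldr F wx ` boundary F K. \<exists>b\<in>foldr F w ` boundary F K. v a = v b)" for w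
  have "P wy"
  proof (rule connected_closed_cover_induct[where W = W and C = "\<lambda>w. foldr F w ` K" and ?w0.0 = wx])
    show "connected (\<Union>w\<in>W. foldr F w ` K)" using assms(1) cells_cover[of m] unfolding W_def by simp
    show "finite W" unfolding W_def using finite_lists_length_eq[of "UNIV :: 'i set" m] by simp
    show "P wx" unfolding P_def by simp
    show "P w'" if W: "w \<in> W" "w' \<in> W" and "P w" and meet: "foldr F w ` K \<inter> foldr F w' ` K \<noteq> {}" for w w'
    proof (cases "w = w'")
      case False
      obtain z where "z \<in> foldr F w ` K" "z \<in> foldr F w' ` K" using meet by blast
      then have z: "z \<in> foldr F w ` boundary F K" "z \<in> foldr F w' ` boundary F K"
        using distinct_cells_meet_in_boundary[OF _ False, of z] W unfolding W_def by auto
      from \<open>P w\<close> show ?thesis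
      proof (unfold P_def, elim disjE bexE)
        assume "w = wx"
        then show "w' = wx \<or> (\<exists>a\<in>foldr F wx ` boundary F K. \<exists>b\<in>foldr F w' ` boundary F K. v a = v b)"
          using z by blast
      next
        fix a b assume "a \<in> foldr F wx ` boundary F K" "b \<in> foldr F w ` boundary F K" "v a = v b"
        then show "w' = wx \<or> (\<exists>a\<in>foldr F wx ` boundary F K. \<exists>b\<in>foldr F w' ` boundary F K. v a = v b)"
          using z const[of b w z] by metis
      qed
    qed (use \<open>P w\<close> in simp)
  qed (use compact_imp_closed[OF compact_cell] K_nonempty wx wy in \<open>auto simp: W_def\<close>)
  then have "dist (v x) (v y) < 2 * e"
    unfolding P_def
  proof (elim disjE bexE)
    assume "wy = wx"
    then show ?thesis using osc[OF wx] wy(2) \<open>0 < e\<close> by fastforce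
  next
    fix a b assume "a \<in> foldr F wx ` boundary F K" "b \<in> foldr F wy ` boundary F K" "v a = v b"
    then have "dist (v x) (v a) < e" "dist (v y) (v a) < e"
      using osc[OF wx, of a] osc[OF wy, of b] boundary_subset by auto
    then show ?thesis using dist_triangle2[of "v x" "v y" "v a"] by linarith
  qed
  then show False unfolding e_def by simp
qed

end

section \<open>Energy forms\<close>

lemma energy0_nonneg:
  assumes "\<And>x y. x \<in> V \<Longrightarrow> y \<in> V \<Longrightarrow> 0 \<le> c x y"
  shows "0 \<le> energy0 V c u u"
  unfolding energy0_def using assms by (auto intro!: sum_nonneg simp: mult.assoc)

lemma energy0_commute: "energy0 V c u v = energy0 V c v u"
  unfolding energy0_def by (simp add: mult_ac)

lemma energy0_comb:
  "energy0 V c (\<lambda>x. u x + a * v x) z = energy0 V c u z + a * energy0 V c v z"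
  unfolding energy0_def sum_distrib_left sum.distrib[symmetric]
  by (intro sum.cong refl) (simp add: algebra_simps)

lemma energy_level_commute: "energy_level F K c r m u v = energy_level F K c r m v u"
  unfolding energy_level_def by (simp add: energy0_commute)

lemma energy_level_comb:
  "energy_level F K c r m (\<lambda>x. u x + a * v x) z
     = energy_level F K c r m u z + a * energy_level F K c r m v z"
proof -
  have "energy0 V c ((\<lambda>x. u x + a * v x) \<circ> g) y = energy0 V c (u \<circ> g) y + a * energy0 V c (v \<circ> g) y"
    for g y V
    using energy0_comb[of V c "u \<circ> g" a "v \<circ> g" y] by (simp add: comp_def)
  then show ?thesis
    unfolding energy_level_def sum_distrib_left sum.distrib[symmetric]
    by (intro sum.cong refl) (simp add: algebra_simps)
qed

lemma energy_level_comb_right: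
  "energy_level F K c r m z (\<lambda>x. u x + a * v x)
     = energy_level F K c r m z u + a * energy_level F K c r m z v"
  unfolding energy_level_commute[of F K c r m z] by (rule energy_level_comb)

lemma energy_level_zero: "energy_level F K c r 0 u v = energy0 (boundary F K) c u v"
proof -
  have "{w :: 'b list. length w = 0} = {[]}" by auto
  then show ?thesis unfolding energy_level_def by (simp add: comp_def)
qed

text \<open>Concatenation identifies pairs of words of lengths \<open>m\<close> and \<open>n\<close> with words of length \<open>m + n\<close>.\<close>
lemma energy_level_self_similar:
  "energy_level F K c r (m + n) u v =
     (\<Sum>w | length w = m. inverse (prod_list (map r w)) *
        energy_level F K c r n (u \<circ> foldr F w) (v \<circ> foldr F w))"
proof -
  let ?f = "\<lambda>w. inverse (prod_list (map r w)) *
    energy0 (boundary F K) c (u \<circ> foldr F w) (v \<circ> foldr F w)"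
  let ?W = "\<lambda>m. {w :: 'a list. length w = m}"
  have bij: "bij_betw (\<lambda>(w, s). w @ s) (?W m \<times> ?W n) (?W (m + n))"
  proof (rule bij_betwI[where g = "\<lambda>w. (take m w, drop m w)"])
  qed auto
  have "energy_level F K c r (m + n) u v = (\<Sum>(w, s)\<in>?W m \<times> ?W n. ?f (w @ s))"
    unfolding energy_level_def
    by (subst sum.reindex_bij_betw[OF bij, symmetric]) (simp add: case_prod_unfold)
  also have "\<dots> = (\<Sum>w\<in>?W m. \<Sum>s\<in>?W n. ?f (w @ s))"
    by (rule sum.cartesian_product[symmetric])
  also have "\<dots> = (\<Sum>w\<in>?W m. inverse (prod_list (map r w)) *
        energy_level F K c r n (u \<circ> foldr F w) (v \<circ> foldr F w))"
    unfolding energy_level_def sum_distrib_left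
    by (intro sum.cong refl) (simp only: foldr_append_comp map_append prod_list.append
      inverse_mult_distrib mult.assoc comp_assoc)
  finally show ?thesis .
qed

locale harmonic_energy =
  fixes F :: "'i::finite \<Rightarrow> 'a::euclidean_space \<Rightarrow> 'a" and K :: "'a set"
    and c :: "'a \<Rightarrow> 'a \<Rightarrow> real" and r :: "'i \<Rightarrow> real"
  assumes harmonic: "harmonic_structure F K c r"
begin

abbreviation "EL \<equiv> energy_level F K c r"

lemma r_pos: "0 < r i"
  using harmonic unfolding harmonic_structure_def Let_def by blast

lemma word_weight_pos: "0 < inverse (prod_list (map r w))"
  by (induction w) (use r_pos in auto)

lemma E0_nonneg: "0 \<le> energy0 (boundary F K) c u u"
  using harmonic unfolding harmonic_structure_def Let_def by (intro energy0_nonneg) blast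

lemma E0_zero_iff: "energy0 (boundary F K) c u u = 0 \<longleftrightarrow> (\<exists>a. \<forall>x\<in>boundary F K. u x = a)"
  using harmonic unfolding harmonic_structure_def Let_def by blast

lemma E0_le_E1: "energy0 (boundary F K) c u u \<le> EL 1 u u"
  using harmonic unfolding harmonic_structure_def Let_def by blast

lemma EL_nonneg: "0 \<le> EL m u u"
  unfolding energy_level_def
  by (intro sum_nonneg mult_nonneg_nonneg E0_nonneg less_imp_le[OF word_weight_pos])

lemma EL_mono: "incseq (\<lambda>m. EL m u u)"
proof (rule incseq_SucI)
  fix m
  have "EL m u u = EL (m + 0) u u" by simp
  also have "\<dots> \<le> EL (m + 1) u u"
    unfolding energy_level_self_similar
    by (intro sum_mono mult_left_mono less_imp_le[OF word_weight_pos])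
      (unfold energy_level_zero, rule E0_le_E1)
  finally show "EL m u u \<le> EL (Suc m) u u" by simp
qed

lemma EL_comb_diag:
  "EL m (\<lambda>x. u x + a * v x) (\<lambda>x. u x + a * v x) = EL m u u + 2 * a * EL m u v + a\<^sup>2 * EL m v v"
  by (simp add: energy_level_comb energy_level_comb_right energy_level_commute[of F K c r m v u]
      algebra_simps power2_eq_square)

text \<open>
  The parallelogram law bounds the level energies of a combination, and bounded monotone sequences
  converge.
\<close>
lemma dom_energy_comb:
  assumes "u \<in> dom_energy F K c r" "v \<in> dom_energy F K c r"
  shows "(\<lambda>x. u x + a * v x) \<in> dom_energy F K c r"
proof -
  let ?z = "\<lambda>x. u x + a * v x"
  have cont: "continuous_on K ?z"
    using assms unfolding dom_energy_def by (auto intro!: continuous_intros)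
  have conv: "convergent (\<lambda>m. EL m u u)" "convergent (\<lambda>m. EL m v v)"
    using assms unfolding dom_energy_def by auto
  have "EL m ?z ?z \<le> 2 * lim (\<lambda>m. EL m u u) + 2 * a\<^sup>2 * lim (\<lambda>m. EL m v v)" for m
  proof -
    have "0 \<le> EL m (\<lambda>x. u x + (-a) * v x) (\<lambda>x. u x + (-a) * v x)" by (rule EL_nonneg)
    then have "EL m ?z ?z \<le> 2 * EL m u u + 2 * a\<^sup>2 * EL m v v"
      unfolding EL_comb_diag by simp
    moreover have "EL m u u \<le> lim (\<lambda>m. EL m u u)"
      using incseq_le[OF EL_mono] conv(1) unfolding convergent_LIMSEQ_iff by blast
    moreover have "2 * a\<^sup>2 * EL m v v \<le> 2 * a\<^sup>2 * lim (\<lambda>m. EL m v v)"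
      using incseq_le[OF EL_mono] conv(2) unfolding convergent_LIMSEQ_iff
      by (intro mult_left_mono) auto
    ultimately show ?thesis by linarith
  qed
  then obtain l where "(\<lambda>m. EL m ?z ?z) \<longlonglongrightarrow> l"
    using incseq_convergent[OF EL_mono[of ?z]] by blast
  then show ?thesis using cont unfolding dom_energy_def convergent_def by blast
qed

text \<open>By polarization, the mixed level energies inherit convergence from the quadratic ones.\<close>
lemma energy_LIMSEQ:
  assumes "u \<in> dom_energy F K c r" "v \<in> dom_energy F K c r"
  shows "(\<lambda>m. EL m u v) \<longlonglongrightarrow> energy F K c r u v"
proof -
  let ?z = "\<lambda>x. u x + 1 * v x"
  have "convergent (\<lambda>m. EL m ?z ?z)" "convergent (\<lambda>m. EL m u u)" "convergent (\<lambda>m. EL m v v)"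
    using dom_energy_comb[OF assms, of 1] assms unfolding dom_energy_def by blast+
  then have "convergent (\<lambda>m. (1/2) * (EL m ?z ?z - EL m u u - EL m v v))"
    by (intro convergent_mult convergent_diff convergent_const)
  then have "convergent (\<lambda>m. EL m u v)" unfolding EL_comb_diag by simp
  then show ?thesis unfolding energy_def convergent_LIMSEQ_iff .
qed

lemma energy_comb:
  assumes "u \<in> dom_energy F K c r" "v \<in> dom_energy F K c r" "z \<in> dom_energy F K c r"
  shows "energy F K c r (\<lambda>x. u x + a * v x) z = energy F K c r u z + a * energy F K c r v z"
proof (rule LIMSEQ_unique)
  show "(\<lambda>m. EL m (\<lambda>x. u x + a * v x) z) \<longlonglongrightarrow> energy F K c r (\<lambda>x. u x + a * v x) z"
    using assms by (intro energy_LIMSEQ dom_energy_comb)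
  show "(\<lambda>m. EL m (\<lambda>x. u x + a * v x) z) \<longlonglongrightarrow> energy F K c r u z + a * energy F K c r v z"
    unfolding energy_level_comb using assms by (intro tendsto_intros energy_LIMSEQ)
qed

lemma harmonic_splines_comb:
  assumes "u \<in> harmonic_splines F K c r E" "v \<in> harmonic_splines F K c r E"
  shows "(\<lambda>x. u x + a * v x) \<in> harmonic_splines F K c r E"
  using assms unfolding harmonic_splines_def by (auto simp: dom_energy_comb energy_comb)

text \<open>
  The level energies are nonnegative and increase to zero, so every summand of every level energy
  vanishes.
\<close>
lemma zero_energy_constant_on_cell_boundaries:
  assumes "u \<in> dom_energy F K c r" "energy F K c r u u = 0"
    and "x \<in> foldr F w ` boundary F K" "y \<in> foldr F w ` boundary F K"
  shows "u x = u y"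
proof -
  have "EL (length w) u u \<le> 0"
    using incseq_le[OF EL_mono energy_LIMSEQ[OF assms(1,1)]] assms(2) by simp
  then have "EL (length w) u u = 0" using EL_nonneg[of "length w" u] by linarith
  moreover have "finite {w' :: 'i list. length w' = length w}"
    using finite_lists_length_eq[of "UNIV :: 'i set" "length w"] by simp
  ultimately have "inverse (prod_list (map r w)) *
      energy0 (boundary F K) c (u \<circ> foldr F w) (u \<circ> foldr F w) = 0"
    unfolding energy_level_def
    by (subst (asm) sum_nonneg_eq_0_iff)
      (auto intro!: mult_nonneg_nonneg E0_nonneg simp del: inverse_nonnegative_iff_nonnegative
        simp: less_imp_le[OF word_weight_pos])
  then have "energy0 (boundary F K) c (u \<circ> foldr F w) (u \<circ> foldr F w) = 0"
    using word_weight_pos[of w] by auto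
  then show ?thesis using assms(3,4) unfolding E0_zero_iff by auto
qed

end

section \<open>Integration of splines\<close>

lemma continuous_integrable_on_compact:
  fixes v :: "'a::euclidean_space \<Rightarrow> real"
  assumes "borel_prob_on K \<mu>" "compact K" "continuous_on K v"
  shows "integrable \<mu> v"
proof -
  have sets: "sets \<mu> = sets (restrict_space borel K)" and "prob_space \<mu>"
    using assms(1) unfolding borel_prob_on_def by auto
  interpret prob_space \<mu> by fact
  have space: "space \<mu> = K" using sets_eq_imp_space_eq[OF sets] by (simp add: space_restrict_space)
  have meas: "v \<in> borel_measurable \<mu>"
    using borel_measurable_continuous_on_restrict[OF assms(3)] measurable_cong_sets[OF sets refl]
    by blast
  obtain B where "\<And>x. x \<in> K \<Longrightarrow> norm (v x) \<le> B"
    using compact_imp_bounded[OF compact_continuous_image[OF assms(3,2)]] unfolding bounded_iff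
    by blast
  then show ?thesis using space meas by (intro integrable_const_bound[where B = B]) auto
qed

theorem theorem2p5:
  fixes F :: "'i::finite \<Rightarrow> 'a::euclidean_space \<Rightarrow> 'a"
    and K E :: "'a set"
    and c :: "'a \<Rightarrow> 'a \<Rightarrow> real"
    and r :: "'i \<Rightarrow> real"
    and \<mu> :: "'a measure"
  assumes "pcf_self_similar_set F K"
    and "connected K"
    and "regular_harmonic_structure F K c r"
    and "borel_prob_on K \<mu>"
    and "nonatomic \<mu>"
    and "positive_on_open K \<mu>"
    and "finite E" and "E \<noteq> {}" and "E \<subseteq> K"
  shows "\<exists>p :: 'a \<Rightarrow> real. \<forall>v\<in>harmonic_splines F K c r E.
           (\<integral>x. v x \<partial>\<mu>) = (\<Sum>x\<in>E. p x * v x)"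
proof -
  interpret self_similar F K
    using assms(1) unfolding pcf_self_similar_set_def by unfold_locales blast
  interpret harmonic_energy F K c r
    using assms(3) unfolding regular_harmonic_structure_def by unfold_locales blast
  have dom: "v \<in> dom_energy F K c r" if "v \<in> harmonic_splines F K c r E" for v
    using that unfolding harmonic_splines_def by blast
  have cont: "continuous_on K v" if "v \<in> harmonic_splines F K c r E" for v
    using dom[OF that] unfolding dom_energy_def by blast
  have int: "integrable \<mu> v" if "v \<in> harmonic_splines F K c r E" for v
    using continuous_integrable_on_compact[OF assms(4) compact_K cont[OF that]] .
  show ?thesis
  proof (rule functional_is_combination_of_evaluations[OF assms(7)])
    fix u v a
    assume uv: "u \<in> harmonic_splines F K c r E" "v \<in> harmonic_splines F K c r E"
    show "(\<lambda>x. u x + a * v x) \<in> harmonic_splines F K c r E"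
      using uv by (rule harmonic_splines_comb)
    show "(\<integral>x. u x + a * v x \<partial>\<mu>) = (\<integral>x. u x \<partial>\<mu>) + a * (\<integral>x. v x \<partial>\<mu>)"
      using int[OF uv(1)] int[OF uv(2)] by simp
  next
    fix v assume v: "v \<in> harmonic_splines F K c r E" "\<forall>x\<in>E. v x = 0"
    obtain e where e: "e \<in> E" "e \<in> K" using assms(8,9) by blast
    have "energy F K c r v v = 0" using v dom unfolding harmonic_splines_def by blast
    note const = zero_energy_constant_on_cell_boundaries[OF dom[OF v(1)] this]
    have zero: "v x = 0" if "x \<in> K" for x
      using constant_if_constant_on_cell_boundaries[OF assms(2) cont[OF v(1)] const
          that e(2)] v(2) e(1)
      by simp
    have "space \<mu> = K"
      using assms(4) sets_eq_imp_space_eq[of \<mu> "restrict_space borel K"]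
      unfolding borel_prob_on_def by (simp add: space_restrict_space)
    then have "(\<integral>x. v x \<partial>\<mu>) = (\<integral>x. 0 \<partial>\<mu>)"
      by (intro Bochner_Integration.integral_cong) (auto simp: zero)
    then show "(\<integral>x. v x \<partial>\<mu>) = 0" by simp
  qed
qed

end
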